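(* Let $\sigma,\rho,\beta>0$, let $K=\frac{\beta^2(\rho+\sigma)^2}{4(\beta-1)}$, and let $(x,y,z)$ be a solution of the Lorenz 63 system lying on its global attractor, so that $x(t)^2+y(t)^2+z(t)^2\le K$ for all $t\in\mathbb{R}$. Let $(\bar x,\bar y,\bar z)$ be the solution on $[0,\infty)$ of the nudged system with continuous-in-time $x$-component observations and parameter $\mu$, $$\frac{d\bar x}{dt}=\sigma(\bar y-\bar x)-\mu(\bar x-x),\qquad \frac{d\bar y}{dt}=\bar x(\rho-\bar z)-\bar y,\qquad \frac{d\bar z}{dt}=\bar x\bar y-\beta\bar z,$$ with $\bar x(0)=\bar y(0)=\bar z(0)=0$. Put $V=(x-\bar x)^2+(y-\bar y)^2+(z-\bar z)^2$. If $$\mu\ge\max\Big\{2,\ \tfrac12+(\rho+\sigma)^2-\sigma+K+\tfrac{K}{2\beta}\Big\},$$ then $$V(t)\le e^{-ct}V(0)\quad\text{for all } t\ge 0,\qquad\text{where } c=\min\{1,\beta\}.$$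
   Context: The Lorenz 63 system with parameters $\sigma,\rho,\beta>0$ is $$\frac{dx}{dt}=\sigma(y-x),\qquad \frac{dy}{dt}=x(\rho-z)-y,\qquad \frac{dz}{dt}=xy-\beta z .$$ Standing assumption: the reference solution $(x,y,z)$ lies on the global attractor of this system, and one has at one's disposal the (cited, known) bound $x(t)^2+y(t)^2+z(t)^2\le K$ for all $t\in\mathbb{R}$, with $K=\frac{\beta^2(\rho+\sigma)^2}{4(\beta-1)}$ (which presupposes that this expression is defined). The number $\mu>0$ is the nudging parameter. *)

theory Defs
  imports "HOL-Analysis.Analysis"
begin

definition lorenz_solution ::
  "real \<Rightarrow> real \<Rightarrow> real \<Rightarrow> real set \<Rightarrow>
   (real \<Rightarrow> real) \<Rightarrow> (real \<Rightarrow> real) \<Rightarrow> (real \<Rightarrow> real) \<Rightarrow> bool"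
  where
  "lorenz_solution \<sigma> \<rho> \<beta> I x y z \<longleftrightarrow> (\<forall>t\<in>I.
     (x has_real_derivative \<sigma> * (y t - x t)) (at t within I) \<and>
     (y has_real_derivative x t * (\<rho> - z t) - y t) (at t within I) \<and>
     (z has_real_derivative x t * y t - \<beta> * z t) (at t within I))"

(* The image S(t)B of B under the time-t map of the Lorenz semigroup, written through
   forward solutions because no ODE flow is available in the imported libraries. The Lorenz
   system has a unique forward solution on [0,\<infinity>) from every initial point, so
   this is the usual S(t)B. *)
definition lorenz_image ::
  "real \<Rightarrow> real \<Rightarrow> real \<Rightarrow> real \<Rightarrow> (real \<times> real \<times> real) set \<Rightarrow> (real \<times> real \<times> real) set"
  where
  "lorenz_image \<sigma> \<rho> \<beta> t B =
     {(x t, y t, z t) | x y z. lorenz_solution \<sigma> \<rho> \<beta> {0..} x y z \<and> (x 0, y 0, z 0) \<in> B}"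

(* Nonempty, compact, invariant (S(t)A = A), and attracting bounded sets uniformly. At most one
   set has these properties. Nonemptiness is listed because infdist to {} is 0 by convention. *)
definition lorenz_global_attractor ::
  "real \<Rightarrow> real \<Rightarrow> real \<Rightarrow> (real \<times> real \<times> real) set \<Rightarrow> bool"
  where
  "lorenz_global_attractor \<sigma> \<rho> \<beta> A \<longleftrightarrow>
     A \<noteq> {} \<and> compact A \<and>
     (\<forall>t\<ge>0. lorenz_image \<sigma> \<rho> \<beta> t A = A) \<and>
     (\<forall>B. bounded B \<longrightarrow>
        (\<forall>e>0. \<forall>\<^sub>F t in at_top. \<forall>p\<in>lorenz_image \<sigma> \<rho> \<beta> t B. infdist p A < e))"

(* x is the observed component of the reference solution; on I = [0,\<infinity>) the
   derivative at 0 is one-sided. *)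
definition nudged_lorenz_solution ::
  "real \<Rightarrow> real \<Rightarrow> real \<Rightarrow> real \<Rightarrow> (real \<Rightarrow> real) \<Rightarrow> real set \<Rightarrow>
   (real \<Rightarrow> real) \<Rightarrow> (real \<Rightarrow> real) \<Rightarrow> (real \<Rightarrow> real) \<Rightarrow> bool"
  where
  "nudged_lorenz_solution \<sigma> \<rho> \<beta> \<mu> x I xb yb zb \<longleftrightarrow> (\<forall>t\<in>I.
     (xb has_real_derivative \<sigma> * (yb t - xb t) - \<mu> * (xb t - x t)) (at t within I) \<and>
     (yb has_real_derivative xb t * (\<rho> - zb t) - yb t) (at t within I) \<and>
     (zb has_real_derivative xb t * yb t - \<beta> * zb t) (at t within I))"

end

theory Submission imports Defs begin

text \<open>
  Why the theorem holds: the synchronisation error \<open>(u, v, w) = (x - xb, y - yb, z - zb)\<close>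
  satisfies an ODE in which the cubic terms \<open>u * v * w\<close> and the products \<open>x * v * w\<close>
  drop out of the energy balance, because the quadratic part of the Lorenz field conserves energy.
  Half the rate of change of \<open>V = u\<^sup>2 + v\<^sup>2 + w\<^sup>2\<close> is therefore a quadratic form in
  \<open>(u, v, w)\<close> whose only indefinite terms, \<open>(\<rho> + \<sigma>) * u * v\<close>,
  \<open>- z * u * v\<close> and \<open>y * u * w\<close>, all contain the observed component \<open>u\<close>.
  Young's inequality splits each of them into a part absorbed by the natural damping of \<open>v\<close> and
  \<open>w\<close> and a multiple of \<open>u\<^sup>2\<close>, bounded through \<open>y\<^sup>2, z\<^sup>2 \<le> K\<close>, which the nudging
  term \<open>- \<mu> * u\<^sup>2\<close> dominates (lemma \<open>error_energy_dissipation\<close>). Half of the damping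
  remains, so that \<open>V' \<le> - c * V\<close>, and Gronwall's inequality (lemma
  \<open>exponential_decay\<close>) gives the decay.
\<close>

text \<open>The product \<open>exp (c * t) * f t\<close> is nonincreasing. Only one-sided differentiability is
  available at the left end point, where continuity suffices.\<close>

lemma exponential_decay:
  fixes f f' :: "real \<Rightarrow> real"
  assumes deriv: "\<And>s. s \<ge> 0 \<Longrightarrow> (f has_real_derivative f' s) (at s within {0..})"
    and bound: "\<And>s. s \<ge> 0 \<Longrightarrow> f' s \<le> - c * f s"
    and "t \<ge> 0"
  shows "f t \<le> exp (- c * t) * f 0"
proof -
  define g where "g = (\<lambda>s. exp (c * s) * f s)"
  have g_deriv: "(g has_real_derivative exp (c * s) * (f' s + c * f s)) (at s within {0..})"
    if "s \<ge> 0" for s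
    unfolding g_def
    by (rule derivative_eq_intros deriv that refl)+ (simp add: algebra_simps)
  have "g t \<le> g 0"
  proof (rule DERIV_nonpos_imp_decreasing_open[OF \<open>t \<ge> 0\<close>])
    fix s :: real
    assume "0 < s"
    then have "at s within {0..} = at s"
      by (intro at_within_interior) (simp add: interior_real_atLeast)
    with g_deriv[of s] \<open>0 < s\<close> have "DERIV g s :> exp (c * s) * (f' s + c * f s)"
      by simp
    moreover have "exp (c * s) * (f' s + c * f s) \<le> 0"
      using bound[of s] \<open>0 < s\<close> by (simp add: mult_le_0_iff)
    ultimately show "\<exists>l. DERIV g s :> l \<and> l \<le> 0" by blast
  next
    have "continuous_on {0..} g"
      by (rule DERIV_continuous_on) (use g_deriv in auto)
    then show "continuous_on {0..t} g"
      by (rule continuous_on_subset) simp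
  qed
  then have "exp (- c * t) * (exp (c * t) * f t) \<le> exp (- c * t) * f 0"
    by (simp add: g_def)
  then show ?thesis
    by (simp add: mult.assoc[symmetric] flip: exp_add)
qed

text \<open>Young's inequality is applied to the indefinite terms with weights that leave exactly half of the damping of \<open>v\<close> and \<open>w\<close>:
  the two \<open>u * v\<close> terms take a quarter of \<open>v\<^sup>2\<close> each, the \<open>u * w\<close> term takes
  \<open>\<beta> / 2\<close> of \<open>w\<^sup>2\<close>. The remaining \<open>1 / 2\<close> in the bound on \<open>\<mu>\<close> pays for
  \<open>c * u\<^sup>2 / 2\<close>.\<close>

lemma error_energy_dissipation:
  fixes \<sigma> \<rho> \<beta> \<mu> K c u v w y z :: real
  assumes "\<beta> > 0" and "y\<^sup>2 \<le> K" and "z\<^sup>2 \<le> K"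
    and "c \<le> 1" and "c \<le> \<beta>"
    and \<mu>: "\<mu> \<ge> 1 / 2 + (\<rho> + \<sigma>)\<^sup>2 - \<sigma> + K + K / (2 * \<beta>)"
  shows "2 * (- (\<sigma> + \<mu>) * u\<^sup>2 - v\<^sup>2 - \<beta> * w\<^sup>2 + (\<rho> + \<sigma>) * u * v - z * u * v + y * u * w)
    \<le> - c * (u\<^sup>2 + v\<^sup>2 + w\<^sup>2)"
proof -
  have uv_linear: "(\<rho> + \<sigma>) * u * v \<le> (\<rho> + \<sigma>)\<^sup>2 * u\<^sup>2 + v\<^sup>2 / 4"
    using zero_le_power2[of "(\<rho> + \<sigma>) * u - v / 2"]
    by (simp add: power2_diff power_mult_distrib power_divide)
  have "- z * u * v \<le> z\<^sup>2 * u\<^sup>2 + v\<^sup>2 / 4"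
    using zero_le_power2[of "z * u + v / 2"]
    by (simp add: power2_sum power_mult_distrib power_divide)
  also have "z\<^sup>2 * u\<^sup>2 \<le> K * u\<^sup>2"
    using \<open>z\<^sup>2 \<le> K\<close> by (intro mult_right_mono) auto
  finally have uv_z: "- z * u * v \<le> K * u\<^sup>2 + v\<^sup>2 / 4" by simp
  have "0 \<le> (y * u - \<beta> * w)\<^sup>2 / (2 * \<beta>)"
    using \<open>\<beta> > 0\<close> by simp
  also have "\<dots> = y\<^sup>2 / (2 * \<beta>) * u\<^sup>2 + \<beta> / 2 * w\<^sup>2 - y * u * w"
    using \<open>\<beta> > 0\<close> by (simp add: field_simps power2_eq_square)
  finally have "y * u * w \<le> y\<^sup>2 / (2 * \<beta>) * u\<^sup>2 + \<beta> / 2 * w\<^sup>2" by simp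
  also have "y\<^sup>2 / (2 * \<beta>) * u\<^sup>2 \<le> K / (2 * \<beta>) * u\<^sup>2"
    using \<open>y\<^sup>2 \<le> K\<close> \<open>\<beta> > 0\<close> by (intro mult_right_mono divide_right_mono) auto
  finally have uw_y: "y * u * w \<le> K / (2 * \<beta>) * u\<^sup>2 + \<beta> / 2 * w\<^sup>2" by simp
  have "(c / 2 + (\<rho> + \<sigma>)\<^sup>2 + K + K / (2 * \<beta>)) * u\<^sup>2 \<le> (\<sigma> + \<mu>) * u\<^sup>2"
    using \<mu> \<open>c \<le> 1\<close> by (intro mult_right_mono) auto
  moreover have "c * v\<^sup>2 \<le> 1 * v\<^sup>2" "c * w\<^sup>2 \<le> \<beta> * w\<^sup>2"
    using \<open>c \<le> 1\<close> \<open>c \<le> \<beta>\<close> by (intro mult_right_mono; simp)+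
  ultimately show ?thesis
    using uv_linear uv_z uw_y by (simp add: algebra_simps)
qed

text \<open>Energy balance of the synchronisation error. With \<open>u, v, w\<close> for the components of the error,
  the difference of the nonlinear terms is \<open>- (x * w + z * u - u * w)\<close> in the \<open>y\<close> equation and
  \<open>x * v + y * u - u * v\<close> in the \<open>z\<close> equation. Multiplied by \<open>v\<close> and \<open>w\<close> and added,
  they leave only \<open>- z * u * v + y * u * w\<close>.\<close>

lemma error_energy_derivative:
  fixes \<sigma> \<rho> \<beta> \<mu> t :: real and x y z xb yb zb :: "real \<Rightarrow> real"
  defines "u \<equiv> \<lambda>s. x s - xb s" and "v \<equiv> \<lambda>s. y s - yb s" and "w \<equiv> \<lambda>s. z s - zb s"
  assumes ref: "lorenz_solution \<sigma> \<rho> \<beta> I x y z"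
    and nudged: "nudged_lorenz_solution \<sigma> \<rho> \<beta> \<mu> x I xb yb zb"
    and "t \<in> I"
  shows "((\<lambda>s. (u s)\<^sup>2 + (v s)\<^sup>2 + (w s)\<^sup>2) has_real_derivative
    2 * (- (\<sigma> + \<mu>) * (u t)\<^sup>2 - (v t)\<^sup>2 - \<beta> * (w t)\<^sup>2
      + (\<rho> + \<sigma>) * u t * v t - z t * u t * v t + y t * u t * w t)) (at t within I)"
proof -
  note ref_deriv = ref[unfolded lorenz_solution_def, rule_format, OF \<open>t \<in> I\<close>]
  note nudged_deriv = nudged[unfolded nudged_lorenz_solution_def, rule_format, OF \<open>t \<in> I\<close>]
  show ?thesis
    unfolding u_def v_def w_def
    by (rule derivative_eq_intros ref_deriv[THEN conjunct1]
        ref_deriv[THEN conjunct2, THEN conjunct1] ref_deriv[THEN conjunct2, THEN conjunct2]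
        nudged_deriv[THEN conjunct1] nudged_deriv[THEN conjunct2, THEN conjunct1]
        nudged_deriv[THEN conjunct2, THEN conjunct2] refl)+
      (simp add: algebra_simps power2_eq_square)
qed

lemma lorenz_solution_subset:
  assumes "lorenz_solution \<sigma> \<rho> \<beta> J x y z" and "I \<subseteq> J"
  shows "lorenz_solution \<sigma> \<rho> \<beta> I x y z"
  using assms unfolding lorenz_solution_def by (blast intro: DERIV_subset)

theorem theorem4p2:
  fixes \<sigma> \<rho> \<beta> \<mu> K c :: real
    and x y z xb yb zb V :: "real \<Rightarrow> real"
    and A :: "(real \<times> real \<times> real) set"
  assumes "\<sigma> > 0" and "\<rho> > 0" and "\<beta> > 0" and "\<mu> > 0"
    and "\<beta> \<noteq> 1"
    and "K = \<beta>\<^sup>2 * (\<rho> + \<sigma>)\<^sup>2 / (4 * (\<beta> - 1))"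
    and "lorenz_solution \<sigma> \<rho> \<beta> UNIV x y z"
    and "lorenz_global_attractor \<sigma> \<rho> \<beta> A"
    and "\<forall>t. (x t, y t, z t) \<in> A"
    and "\<forall>t. (x t)\<^sup>2 + (y t)\<^sup>2 + (z t)\<^sup>2 \<le> K"
    and "nudged_lorenz_solution \<sigma> \<rho> \<beta> \<mu> x {0..} xb yb zb"
    and "xb 0 = 0" and "yb 0 = 0" and "zb 0 = 0"
    and "\<forall>t\<ge>0. V t = (x t - xb t)\<^sup>2 + (y t - yb t)\<^sup>2 + (z t - zb t)\<^sup>2"
    and "\<mu> \<ge> max 2 (1 / 2 + (\<rho> + \<sigma>)\<^sup>2 - \<sigma> + K + K / (2 * \<beta>))"
    and "c = min 1 \<beta>"
  shows "\<forall>t\<ge>0. V t \<le> exp (- c * t) * V 0"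
proof (intro allI impI)
  fix t :: real
  assume "t \<ge> 0"
  let ?E = "\<lambda>s. (x s - xb s)\<^sup>2 + (y s - yb s)\<^sup>2 + (z s - zb s)\<^sup>2"
  have ref: "lorenz_solution \<sigma> \<rho> \<beta> {0..} x y z"
    using assms(7) by (rule lorenz_solution_subset) simp
  have "?E t \<le> exp (- c * t) * ?E 0"
  proof (rule exponential_decay[OF _ _ \<open>t \<ge> 0\<close>])
    fix s :: real
    assume "s \<ge> 0"
    then show "(?E has_real_derivative
        2 * (- (\<sigma> + \<mu>) * (x s - xb s)\<^sup>2 - (y s - yb s)\<^sup>2 - \<beta> * (z s - zb s)\<^sup>2
          + (\<rho> + \<sigma>) * (x s - xb s) * (y s - yb s) - z s * (x s - xb s) * (y s - yb s)
          + y s * (x s - xb s) * (z s - zb s))) (at s within {0..})"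
      using error_energy_derivative[OF ref assms(11)] by simp
  next
    fix s :: real
    have "(x s)\<^sup>2 + (y s)\<^sup>2 + (z s)\<^sup>2 \<le> K"
      using assms(10) by blast
    then have "(y s)\<^sup>2 \<le> K" "(z s)\<^sup>2 \<le> K"
      using zero_le_power2[of "x s"] zero_le_power2[of "y s"] zero_le_power2[of "z s"]
      by linarith+
    then show "2 * (- (\<sigma> + \<mu>) * (x s - xb s)\<^sup>2 - (y s - yb s)\<^sup>2 - \<beta> * (z s - zb s)\<^sup>2
          + (\<rho> + \<sigma>) * (x s - xb s) * (y s - yb s) - z s * (x s - xb s) * (y s - yb s)
          + y s * (x s - xb s) * (z s - zb s)) \<le> - c * ?E s"
      using assms(3,16,17) by (intro error_energy_dissipation) auto
  qed
  then show "V t \<le> exp (- c * t) * V 0"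
    using assms(15) \<open>t \<ge> 0\<close> by simp
qed

end
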